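(* For any $\varepsilon>0$ there exist infinitely many positive integers $N$ such that the set $$\{n^3 : n\in\mathbb{N},\ N\le n \le N+N^{4/7-\varepsilon}\}$$ is a Sidon set.
   Context: $\mathbb{N}$ denotes the positive integers. A set $\mathcal{A}$ of integers is called a Sidon set if the equation $a_1+a_2=a_3+a_4$ with $a_1,a_2,a_3,a_4\in\mathcal{A}$ has only trivial solutions, i.e. every solution satisfies $\{a_1,a_2\}=\{a_3,a_4\}$. *)

theory Defs
  imports Complex_Main
begin

definition sidon_set :: "int set \<Rightarrow> bool" where
  "sidon_set A \<longleftrightarrow>
     (\<forall>a\<^sub>1\<in>A. \<forall>a\<^sub>2\<in>A. \<forall>a\<^sub>3\<in>A. \<forall>a\<^sub>4\<in>A.
        a\<^sub>1 + a\<^sub>2 = a\<^sub>3 + a\<^sub>4 \<longrightarrow> {a\<^sub>1, a\<^sub>2} = {a\<^sub>3, a\<^sub>4})"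

end

theory Submission
  imports Defs "HOL-Computational_Algebra.Primes"
begin

text \<open>
  Suppose \<open>n1^3 + n2^3 = n3^3 + n4^3\<close> with all \<open>n_i\<close> in \<open>[N, N + H]\<close> and the pairs different.  Then
  the sums \<open>n1 + n2\<close> and \<open>b = n3 + n4\<close> differ, say \<open>n1 + n2 = b + h\<close> with \<open>h > 0\<close>.  In terms of
  \<open>c = |n1 - n2|\<close> and \<open>d = |n3 - n4|\<close>, both at most \<open>H\<close>, the equation becomes
  \<open>3 b m = h (h^2 + 3 c^2)\<close> with the integer \<open>m = d^2 - c^2 - h^2 - b h\<close>.  As \<open>b\<close> is about \<open>2 N\<close>, this
  forces \<open>h\<close> to be at most about \<open>H^2 / N\<close> and \<open>m\<close> at most about \<open>H^4 / N^2\<close>.  Eliminating \<open>b\<close> shows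
  that \<open>(d, c)\<close> lies on a conic that depends only on \<open>h\<close> and \<open>m\<close>:
  \<open>(3 m d)^2 - 9 m (m + h^2) c^2 = 3 m (3 m^2 + 3 m h^2 + h^4)\<close>.

  On a conic \<open>x^2 - D y^2 = M\<close> the points whose ordinates agree up to a factor \<open>3/2\<close> number at most
  the square of the number of divisors of \<open>M\<close> (\<open>pell_cluster_card\<close>), hence \<open>O(N^\<delta>)\<close> for each
  \<open>\<delta> > 0\<close> (\<open>divisor_bound\<close>).  For \<open>X \<le> N < 2 X\<close> the sum \<open>b\<close> varies by a factor of about \<open>2\<close> and
  \<open>c^2\<close> is nearly proportional to \<open>b\<close>, so \<open>c\<close> does have this property.  Thus at most
  \<open>O(H^6 / X^3 * X^\<delta>)\<close> values \<open>b\<close> occur (\<open>card_colliding_sums\<close>).  Each one spoils at most \<open>H + 1\<close>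
  starting points \<open>N\<close>, so some \<open>N\<close> survives as soon as \<open>H^7 X^\<delta>\<close> is small compared with \<open>X^4\<close>
  (\<open>exists_sidon_interval\<close>).  This is where the exponent \<open>4/7\<close> comes from.
\<close>

section \<open>The divisor bound\<close>

definition divisor_count :: "nat \<Rightarrow> nat" where
  "divisor_count n = card {d. d dvd n}"

lemma divisor_count_mult_le:
  assumes "m > 0" "n > 0"
  shows "divisor_count (m * n) \<le> divisor_count m * divisor_count n"
proof -
  let ?P = "{d. d dvd m} \<times> {d. d dvd n}"
  have fin: "finite ?P"
    using assms by (simp add: finite_divisors_nat)
  have "{d. d dvd m * n} \<subseteq> (\<lambda>(d, e). d * e) ` ?P"
  proof
    fix d assume "d \<in> {d. d dvd m * n}"
    then obtain b c where "d = b * c" "b dvd m" "c dvd n"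
      using division_decomp[of d m n] by auto
    thus "d \<in> (\<lambda>(d, e). d * e) ` ?P" by (intro image_eqI[of _ _ "(b, c)"]) auto
  qed
  hence "card {d. d dvd m * n} \<le> card ?P"
    using fin surj_card_le by blast
  thus ?thesis
    by (simp add: divisor_count_def card_cartesian_product)
qed

lemma divisor_count_prime_power_le:
  assumes "prime (p::nat)"
  shows "divisor_count (p ^ a) \<le> a + 1"
proof -
  have "{d. d dvd p ^ a} \<subseteq> (\<lambda>i. p ^ i) ` {..a}"
    using divides_primepow_nat[OF assms] by auto
  hence "card {d. d dvd p ^ a} \<le> card {..a}"
    using surj_card_le by blast
  thus ?thesis by (simp add: divisor_count_def)
qed

text \<open>The factor that one small prime contributes to the divisor bound.  It is important that \<open>K\<close>
  depends on neither \<open>a\<close> nor \<open>p\<close>; it is obtained from \<open>exp x \<ge> 1 + x\<close>.\<close>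

lemma linear_le_exponential:
  fixes \<delta> :: real
  assumes "\<delta> > 0"
  obtains K where "K \<ge> 1" "\<And>a p :: nat. p \<ge> 2 \<Longrightarrow> real a + 1 \<le> K * real (p ^ a) powr \<delta>"
proof
  define L where "L = \<delta> * ln 2"
  have L: "L > 0" using assms by (simp add: L_def)
  show "max 1 (1 / L) \<ge> 1" by simp
  fix a p :: nat
  assume p: "p \<ge> 2"
  have "ln 2 \<le> ln (real p)" using p by simp
  hence "L \<le> \<delta> * ln (real p)" using assms by (simp add: L_def)
  have "1 + real a * L \<le> exp (real a * L)" by (rule exp_ge_add_one_self)
  also have "\<dots> \<le> exp (real a * (\<delta> * ln (real p)))"
    using \<open>L \<le> _\<close> by (simp add: mult_left_mono)
  also have "\<dots> = real (p ^ a) powr \<delta>"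
    using p by (simp add: powr_def ln_realpow mult_ac)
  finally have *: "1 + real a * L \<le> real (p ^ a) powr \<delta>" .
  have "real a + 1 \<le> max 1 (1 / L) * (1 + real a * L)"
  proof -
    have "real a = (1 / L) * (real a * L)" using L by simp
    also have "\<dots> \<le> max 1 (1 / L) * (real a * L)"
      using L by (intro mult_right_mono) auto
    finally show ?thesis by (simp add: algebra_simps)
  qed
  also have "\<dots> \<le> max 1 (1 / L) * real (p ^ a) powr \<delta>"
    using * by (intro mult_left_mono) auto
  finally show "real a + 1 \<le> max 1 (1 / L) * real (p ^ a) powr \<delta>" .
qed

text \<open>Splitting off the full power of the largest admitted prime multiplies the constant by one factor
  \<open>K\<close> of the preceding lemma, so the constant grows with \<open>k\<close> but not with \<open>n\<close>.\<close>

lemma divisor_bound_smooth: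
  fixes \<delta> :: real
  assumes "\<delta> > 0"
  shows "\<exists>C\<ge>1. \<forall>n>0. (\<forall>p. prime p \<longrightarrow> p dvd n \<longrightarrow> p < k) \<longrightarrow>
           real (divisor_count n) \<le> C * real n powr \<delta>"
proof (induction k)
  case 0
  have none: "n = 1" if "\<forall>p::nat. prime p \<longrightarrow> \<not> p dvd n" for n :: nat
    using that prime_factor_nat by blast
  have "real (divisor_count n) \<le> 1 * real n powr \<delta>" if "\<forall>p. prime p \<longrightarrow> p dvd n \<longrightarrow> p < 0" for n
  proof -
    have "n = 1" using that none[of n] by blast
    thus ?thesis by (simp add: divisor_count_def)
  qed
  thus ?case by (intro exI[of _ 1]) simp
next
  case (Suc k)
  then obtain C where C: "C \<ge> 1" and
    IH: "\<And>n. n > 0 \<Longrightarrow> (\<And>p. prime p \<Longrightarrow> p dvd n \<Longrightarrow> p < k) \<Longrightarrow>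
           real (divisor_count n) \<le> C * real n powr \<delta>" by blast
  obtain K where K: "K \<ge> 1"
    "\<And>a p :: nat. p \<ge> 2 \<Longrightarrow> real a + 1 \<le> K * real (p ^ a) powr \<delta>"
    using linear_le_exponential[OF assms] by blast
  have "real (divisor_count n) \<le> K * C * real n powr \<delta>"
    if n: "n > 0" and smooth: "\<And>p. prime p \<Longrightarrow> p dvd n \<Longrightarrow> p < Suc k" for n
  proof (cases "prime k")
    case True
    define a where "a = multiplicity k n"
    obtain r where r: "n = k ^ a * r" "\<not> k dvd r"
      using multiplicity_decompose'[of n k] n True unfolding a_def
      by (metis not_prime_unit neq0_conv)
    have r0: "r > 0" using r n by (intro gr0I) auto
    have k2: "k \<ge> 2" using True prime_ge_2_nat by blast
    have "p < k" if "prime p" "p dvd r" for p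
      using smooth[of p] that r by (metis dvd_mult less_SucE)
    hence dr: "real (divisor_count r) \<le> C * real r powr \<delta>"
      using IH r0 by blast
    have "divisor_count n \<le> divisor_count (k ^ a) * divisor_count r"
      unfolding r(1) using r0 k2 by (intro divisor_count_mult_le) auto
    also have "\<dots> \<le> (a + 1) * divisor_count r"
      using divisor_count_prime_power_le[OF True] by (rule mult_right_mono) simp
    finally have "real (divisor_count n) \<le> (real a + 1) * real (divisor_count r)"
      by (metis of_nat_1 of_nat_add of_nat_le_iff of_nat_mult)
    also have "\<dots> \<le> (K * real (k ^ a) powr \<delta>) * (C * real r powr \<delta>)"
      using K k2 dr C by (intro mult_mono) auto
    also have "\<dots> = K * C * real n powr \<delta>"
      unfolding r(1) by (simp add: powr_mult)
    finally show ?thesis .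
  next
    case False
    have "p < k" if "prime p" "p dvd n" for p
      using smooth[of p] that False by (metis less_SucE)
    hence "real (divisor_count n) \<le> C * real n powr \<delta>" using IH n by blast
    also have "\<dots> \<le> K * C * real n powr \<delta>"
      using K(1) C by (intro mult_right_mono) auto
    finally show ?thesis .
  qed
  moreover have "K * C \<ge> 1" using K(1) C mult_mono[of 1 K 1 C] by simp
  ultimately show ?case by blast
qed

text \<open>A prime \<open>p\<close> with \<open>p powr \<delta> \<ge> 2\<close> can be divided out for free: it at most doubles the number of
  divisors, while \<open>n powr \<delta>\<close> grows at least by a factor of two.  What remains has bounded prime
  factors only.\<close>

lemma divisor_bound:
  fixes \<delta> :: real
  assumes "\<delta> > 0"
  obtains C where "C \<ge> 1" "\<And>n. n > 0 \<Longrightarrow> real (divisor_count n) \<le> C * real n powr \<delta>"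
proof -
  \<comment> \<open>Primes from \<open>k\<close> on satisfy \<open>p powr \<delta> \<ge> 2\<close>.\<close>
  obtain k :: nat where k: "2 powr (1 / \<delta>) < real k"
    using reals_Archimedean2 by blast
  obtain C where C: "C \<ge> 1" and
    smooth: "\<And>n. n > 0 \<Longrightarrow> (\<And>p. prime p \<Longrightarrow> p dvd n \<Longrightarrow> p < k) \<Longrightarrow>
           real (divisor_count n) \<le> C * real n powr \<delta>"
    using divisor_bound_smooth[OF assms, of k] by blast
  have "real (divisor_count n) \<le> C * real n powr \<delta>" if "n > 0" for n
    using that
  proof (induction n rule: less_induct)
    case (less n)
    show ?case
    proof (cases "\<exists>p. prime p \<and> p dvd n \<and> k \<le> p")
      case False
      hence "p < k" if "prime p" "p dvd n" for p using that by (meson not_le)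
      thus ?thesis using smooth[of n] less.prems by blast
    next
      case True
      then obtain p r where p: "prime p" "k \<le> p" and n: "n = p * r"
        by blast
      have pos: "r > 0" "p > 1" using n less.prems p(1) prime_gt_1_nat by auto
      have IH: "real (divisor_count r) \<le> C * real r powr \<delta>"
        using less.IH[of r] pos n by simp
      have "2 = (2 powr (1 / \<delta>)) powr \<delta>" using assms by (simp add: powr_powr)
      also have "\<dots> \<le> real p powr \<delta>"
        using k p(2) assms by (intro powr_mono2) auto
      finally have two: "2 \<le> real p powr \<delta>" .
      have "divisor_count n \<le> divisor_count p * divisor_count r"
        unfolding n using pos by (intro divisor_count_mult_le) auto
      also have "\<dots> \<le> 2 * divisor_count r"
        using divisor_count_prime_power_le[OF p(1), of 1] by simp
      finally have "real (divisor_count n) \<le> 2 * real (divisor_count r)"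
        by linarith
      also have "\<dots> \<le> real p powr \<delta> * (C * real r powr \<delta>)"
        using two IH by (intro mult_mono) auto
      also have "\<dots> = C * real n powr \<delta>"
        unfolding n by (simp add: powr_mult)
      finally show ?thesis .
    qed
  qed
  with C show ?thesis using that by blast
qed

section \<open>Clusters of points on a Pell conic\<close>

definition pos_divisors :: "int \<Rightarrow> int set" where
  "pos_divisors M = {e. e > 0 \<and> e dvd M}"

lemma finite_pos_divisors: "M > 0 \<Longrightarrow> finite (pos_divisors M)"
  unfolding pos_divisors_def by (rule finite_subset[of _ "{1..M}"]) (auto intro: zdvd_imp_le)

lemma card_pos_divisors:
  assumes "M > 0"
  shows "card (pos_divisors M) = divisor_count (nat M)"
proof -
  have "pos_divisors M = int ` {d. d dvd nat M}"
  proof (intro set_eqI iffI)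
    fix e assume "e \<in> pos_divisors M"
    hence "e = int (nat e)" "nat e dvd nat M"
      using assms by (auto simp: pos_divisors_def nat_dvd_iff)
    thus "e \<in> int ` {d. d dvd nat M}" by blast
  next
    fix e assume "e \<in> int ` {d. d dvd nat M}"
    then obtain d where d: "e = int d" "d dvd nat M" by blast
    have "d > 0" using d(2) assms by (intro gr0I) auto
    thus "e \<in> pos_divisors M" using d assms
      by (auto simp: pos_divisors_def int_dvd_int_iff[symmetric])
  qed
  thus ?thesis by (simp add: divisor_count_def card_image)
qed

lemma pos_divisors_mono: "a dvd b \<Longrightarrow> pos_divisors a \<subseteq> pos_divisors b"
  by (auto simp: pos_divisors_def intro: dvd_trans)

text \<open>For solutions of \<open>x^2 - D y^2 = M\<close>, the product of \<open>x1 y0 - x0 y1\<close> and \<open>x1 y0 + x0 y1\<close> is divisible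
  by \<open>M\<close>.  The class of \<open>(x1, y1)\<close> relative to a reference solution \<open>(x0, y0)\<close> records the part
  \<open>e\<close> of \<open>M\<close> that goes into the first factor; the cofactor \<open>e'\<close> then divides the second one.  This
  replaces the square root \<open>x / y\<close> of \<open>D\<close> modulo \<open>M\<close>: for two solutions in one class, both \<open>e\<close> and
  \<open>e'\<close> divide \<open>V = x1 y2 - x2 y1\<close>.  Only the common divisor \<open>f\<close> of \<open>e\<close> and \<open>e'\<close> separates this from
  \<open>M dvd V\<close>, and \<open>f\<close> divides \<open>2\<close>, since otherwise \<open>D\<close> and \<open>M\<close> would share a square.\<close>

lemma pell_same_class:
  fixes D M :: int
  assumes M: "M > 0"
    and sqf: "\<And>k. k > 0 \<Longrightarrow> k\<^sup>2 dvd D \<Longrightarrow> k\<^sup>2 dvd M \<Longrightarrow> k = 1"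
    and sol: "x0\<^sup>2 - D * y0\<^sup>2 = M" "x1\<^sup>2 - D * y1\<^sup>2 = M" "x2\<^sup>2 - D * y2\<^sup>2 = M"
    and cop: "coprime x0 y0" "coprime x1 y1"
    and cls: "gcd (x1 * y0 - x0 * y1) M = gcd (x2 * y0 - x0 * y2) M"
  shows "M dvd 2 * (x1 * y2 - x2 * y1)"
proof -
  have copM: "coprime y M" if "x\<^sup>2 - D * y\<^sup>2 = M" "coprime x y" for x y
  proof (rule coprimeI)
    fix q assume q: "q dvd y" "q dvd M"
    have "x\<^sup>2 = M + D * y\<^sup>2" using that by simp
    hence "q dvd x\<^sup>2" using q by (simp add: power2_eq_square)
    moreover have "coprime (x\<^sup>2) q" using that(2) q(1)
      by (metis coprime_divisors coprime_power_left_iff dvd_refl)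
    ultimately show "is_unit q" using coprime_common_divisor[of "x\<^sup>2" q q] by simp
  qed
  have c0: "coprime y0 M" and c1: "coprime y1 M" 
    using copM[OF sol(1) cop(1)] copM[OF sol(2) cop(2)] .
  define e where "e = gcd (x1 * y0 - x0 * y1) M"
  have e0: "e > 0" using M by (simp add: e_def)
  obtain e' where e': "M = e * e'" by (metis e_def gcd_dvd2 dvdE)
  have cancel: "e' dvd x * y0 + x0 * y"
    if s: "x\<^sup>2 - D * y\<^sup>2 = M" and g: "gcd (x * y0 - x0 * y) M = e" for x y
  proof -
    obtain u where u: "x * y0 - x0 * y = e * u" by (metis g gcd_dvd1 dvdE)
    have "e * gcd u e' = e" using g e0 unfolding u e' by (simp add: gcd_mult_left)
    hence "coprime u e'" using e0 by (simp add: coprime_iff_gcd_eq_1)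
    have "(x * y0 - x0 * y) * (x * y0 + x0 * y) = M * (y0\<^sup>2 - y\<^sup>2)"
    proof -
      have "x\<^sup>2 = M + D * y\<^sup>2" "x0\<^sup>2 = M + D * y0\<^sup>2" using s sol(1) by simp_all
      hence "x\<^sup>2 * y0\<^sup>2 - x0\<^sup>2 * y\<^sup>2 = M * (y0\<^sup>2 - y\<^sup>2)" by (simp add: algebra_simps)
      thus ?thesis by (simp add: algebra_simps power2_eq_square)
    qed
    hence "u * (x * y0 + x0 * y) = e' * (y0\<^sup>2 - y\<^sup>2)"
      using e0 unfolding u e' by simp
    hence "e' dvd u * (x * y0 + x0 * y)" by simp
    thus ?thesis using \<open>coprime u e'\<close>
      by (metis coprime_commute coprime_dvd_mult_right_iff)
  qed
  have A1: "e dvd x1 * y0 - x0 * y1" and A2: "e dvd x2 * y0 - x0 * y2"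
    unfolding e_def by (simp, unfold cls, simp)
  have B1: "e' dvd x1 * y0 + x0 * y1" and B2: "e' dvd x2 * y0 + x0 * y2"
    using cancel[OF sol(2)] cancel[OF sol(3)] cls by (simp_all add: e_def)
  let ?V = "x1 * y2 - x2 * y1"
  have ce: "coprime y0 e" "coprime y0 e'" using c0 unfolding e' by simp_all
  have "y0 * ?V = (x1 * y0 - x0 * y1) * y2 - (x2 * y0 - x0 * y2) * y1"
    by (simp add: algebra_simps)
  hence "e dvd y0 * ?V" using A1 A2 by simp
  hence eV: "e dvd ?V" using ce by (metis coprime_commute coprime_dvd_mult_right_iff)
  have "y0 * ?V = (x1 * y0 + x0 * y1) * y2 - (x2 * y0 + x0 * y2) * y1"
    by (simp add: algebra_simps)
  hence "e' dvd y0 * ?V" using B1 B2 by (metis dvd_diff dvd_mult2)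
  hence eV': "e' dvd ?V" using ce by (metis coprime_commute coprime_dvd_mult_right_iff)
  define f where "f = gcd e e'"
  have f0: "f > 0" using e0 by (simp add: f_def)
  have fdvd: "f dvd e" "f dvd e'" by (simp_all add: f_def)
  have f2M: "f\<^sup>2 dvd M" unfolding e' power2_eq_square using fdvd by (rule mult_dvd_mono)
  have "f dvd (x1 * y0 - x0 * y1) + (x1 * y0 + x0 * y1)"
    using fdvd A1 B1 by (meson dvd_add dvd_trans)
  hence "f dvd y0 * (2 * x1)" by (simp add: algebra_simps)
  moreover have "coprime f y0" using ce fdvd
    by (meson coprime_commute coprime_divisors dvd_refl)
  ultimately have f2x: "f dvd 2 * x1" by (simp add: coprime_dvd_mult_right_iff)
  have "f dvd 2"
  proof -
    \<comment> \<open>\<open>k\<close> is \<open>f\<close> or \<open>f / 2\<close>, chosen so that \<open>k dvd x1\<close> follows from \<open>f dvd 2 * x1\<close>.  Its square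
      divides \<open>M\<close> and \<open>x1^2\<close>, hence \<open>D\<close>.\<close>
    obtain k where k: "k > 0" "k dvd f" "k dvd x1" "f dvd 2 * k"
    proof (cases "even f")
      case True
      then obtain k where "f = 2 * k" by (elim evenE)
      thus ?thesis using f0 f2x that[of k] by simp
    next
      case False
      hence "f dvd x1" using f2x
        by (metis coprime_commute coprime_dvd_mult_right_iff coprime_left_2_iff_odd)
      thus ?thesis using f0 that[of f] by simp
    qed
    have kM: "k\<^sup>2 dvd M" using k(2) f2M by (meson dvd_power_same dvd_trans)
    have "D * y1\<^sup>2 = x1\<^sup>2 - M" using sol(2) by simp
    hence "k\<^sup>2 dvd D * y1\<^sup>2" using kM k(3) by (simp add: dvd_power_same)
    moreover have "coprime k y1" using cop(2) k(3)
      by (meson coprime_divisors dvd_refl)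
    hence "coprime (k\<^sup>2) (y1\<^sup>2)" by simp
    ultimately have "k\<^sup>2 dvd D" by (simp add: coprime_dvd_mult_left_iff)
    hence "k = 1" using sqf k(1) kM by blast
    thus ?thesis using k(4) by simp
  qed
  have "e' > 0" using M e0 e' by (simp add: zero_less_mult_iff)
  hence "e * e' = f * lcm e e'"
    using prod_gcd_lcm_int[of e e'] e0 by (simp add: f_def)
  moreover have "f * lcm e e' dvd 2 * ?V"
    using \<open>f dvd 2\<close> eV eV' by (intro mult_dvd_mono lcm_least)
  ultimately show ?thesis unfolding e' by simp
qed

text \<open>The identity \<open>V W = M (y2^2 - y1^2)\<close> for \<open>V = x1 y2 - x2 y1\<close> and \<open>W = x1 y2 + x2 y1\<close> makes a
  nonzero multiple \<open>2 V\<close> of \<open>M\<close> impossible: it would give \<open>2 |y2^2 - y1^2| \<ge> W > 2 y1 y2\<close>, so that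
  the ratio of the two ordinates would exceed the golden ratio and hence \<open>3/2\<close>.\<close>

lemma pell_spacing:
  fixes D M :: int
  assumes "D > 0" "M > 0" "x1 > 0" "y1 > 0" "x2 > 0" "y2 > 0"
    and sol: "x1\<^sup>2 - D * y1\<^sup>2 = M" "x2\<^sup>2 - D * y2\<^sup>2 = M"
    and M2: "M dvd 2 * (x1 * y2 - x2 * y1)"
    and close: "2 * y2 \<le> 3 * y1" "2 * y1 \<le> 3 * y2"
  shows "x1 = x2 \<and> y1 = y2"
proof -
  let ?V = "x1 * y2 - x2 * y1"
  let ?W = "x1 * y2 + x2 * y1"
  have sq: "x1\<^sup>2 = M + D * y1\<^sup>2" "x2\<^sup>2 = M + D * y2\<^sup>2" using sol by simp_all
  have "x1\<^sup>2 * y2\<^sup>2 - x2\<^sup>2 * y1\<^sup>2 = M * (y2\<^sup>2 - y1\<^sup>2)"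
    unfolding sq by (simp add: algebra_simps)
  hence VW: "?V * ?W = M * (y2\<^sup>2 - y1\<^sup>2)"
    by (simp add: algebra_simps power2_eq_square)
  have gt: "x > y" if "x\<^sup>2 = M + D * y\<^sup>2" "x > 0" for x y
  proof -
    have "1 * y\<^sup>2 \<le> D * y\<^sup>2" using assms(1) by (intro mult_right_mono) auto
    hence "y\<^sup>2 < x\<^sup>2" using that assms(2) by simp
    thus ?thesis using that(2) by (simp add: power2_less_imp_less)
  qed
  have "?V = 0"
  proof (rule ccontr)
    assume "?V \<noteq> 0"
    hence "M \<le> \<bar>2 * ?V\<bar>" using M2 assms(2) zdvd_imp_le[of M "\<bar>2 * ?V\<bar>"] by simp
    have Wpos: "?W > 2 * (y1 * y2)"
    proof -
      have "y1 * y2 < x1 * y2" "y2 * y1 < x2 * y1"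
        using gt sq assms by (simp_all add: mult_strict_right_mono)
      thus ?thesis by (simp add: mult.commute)
    qed
    have W0: "?W > 0" using Wpos assms(4,6) mult_pos_pos[of y1 y2] by linarith
    have "M * ?W \<le> \<bar>2 * ?V\<bar> * ?W"
      using \<open>M \<le> _\<close> W0 by (intro mult_right_mono) auto
    also have "\<dots> = 2 * \<bar>?V * ?W\<bar>"
      using W0 unfolding abs_mult by simp
    also have "\<dots> = M * (2 * \<bar>y2\<^sup>2 - y1\<^sup>2\<bar>)" unfolding VW using assms(2) by (simp add: abs_mult)
    finally have "?W \<le> 2 * \<bar>y2\<^sup>2 - y1\<^sup>2\<bar>" using assms(2) by simp
    with Wpos have "2 * (y1 * y2) < 2 * \<bar>y2\<^sup>2 - y1\<^sup>2\<bar>" by (rule less_le_trans)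
    hence lt: "y1 * y2 < \<bar>y2\<^sup>2 - y1\<^sup>2\<bar>" by simp
    have upper: "v\<^sup>2 - u\<^sup>2 \<le> u * v" if "u > 0" "u \<le> v" "2 * v \<le> 3 * u" for u v :: int
    proof -
      have "2 * (v\<^sup>2 - u\<^sup>2) = (2 * (v - u)) * (v + u)"
        by (simp add: algebra_simps power2_eq_square)
      also have "\<dots> \<le> u * (v + u)" using that by (intro mult_right_mono) auto
      also have "\<dots> \<le> u * (2 * v)" using that by (intro mult_left_mono) auto
      finally show ?thesis by simp
    qed
    show False
    proof (cases "y1 \<le> y2")
      case True
      hence "\<bar>y2\<^sup>2 - y1\<^sup>2\<bar> = y2\<^sup>2 - y1\<^sup>2" using assms(4) by (simp add: power_mono)
      thus False using lt upper[of y1 y2] True assms(4) close by simp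
    next
      case False
      hence "\<bar>y2\<^sup>2 - y1\<^sup>2\<bar> = y1\<^sup>2 - y2\<^sup>2" using assms(6) by (simp add: power_mono)
      thus False using lt upper[of y2 y1] False assms(6) close by (simp add: mult.commute)
    qed
  qed
  hence "y2\<^sup>2 = y1\<^sup>2" using VW assms(2) by simp
  hence y: "y2 = y1" using assms(4,6) by simp
  hence "x1\<^sup>2 = x2\<^sup>2" using sq by simp
  thus ?thesis using y assms(3,5) by simp
qed

text \<open>The closeness condition runs over all ordered pairs and so bounds the ratio of two ordinates from
  both sides.\<close>

definition pell_cluster :: "int \<Rightarrow> int \<Rightarrow> (int \<times> int) set \<Rightarrow> bool" where
  "pell_cluster D M S \<longleftrightarrow>
     (\<forall>x y. (x, y) \<in> S \<longrightarrow> x > 0 \<and> y > 0 \<and> x\<^sup>2 - D * y\<^sup>2 = M) \<and>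
     (\<forall>x1 y1 x2 y2. (x1, y1) \<in> S \<longrightarrow> (x2, y2) \<in> S \<longrightarrow> 2 * y2 \<le> 3 * y1)"

lemma pell_clusterI:
  assumes "\<And>x y. (x, y) \<in> S \<Longrightarrow> x > 0 \<and> y > 0 \<and> x\<^sup>2 - D * y\<^sup>2 = M"
    and "\<And>x1 y1 x2 y2. (x1, y1) \<in> S \<Longrightarrow> (x2, y2) \<in> S \<Longrightarrow> 2 * y2 \<le> 3 * y1"
  shows "pell_cluster D M S"
  using assms unfolding pell_cluster_def by blast

text \<open>By the two preceding lemmas a class contains at most one point, and classes are divisors of
  \<open>M\<close>.\<close>

lemma pell_cluster_primitive:
  assumes "D > 0" "M > 0"
    and sqf: "\<And>k. k > 0 \<Longrightarrow> k\<^sup>2 dvd D \<Longrightarrow> k\<^sup>2 dvd M \<Longrightarrow> k = 1"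
    and S: "pell_cluster D M S" and cop: "\<And>x y. (x, y) \<in> S \<Longrightarrow> coprime x y"
  shows "finite S \<and> card S \<le> card (pos_divisors M)"
proof (cases "S = {}")
  case False
  then obtain x0 y0 where 0: "(x0, y0) \<in> S" by auto
  define cls where "cls = (\<lambda>(x, y). gcd (x * y0 - x0 * y) M)"
  have sol: "x > 0 \<and> y > 0 \<and> x\<^sup>2 - D * y\<^sup>2 = M" if "(x, y) \<in> S" for x y
    using S that unfolding pell_cluster_def by blast
  have close: "2 * y2 \<le> 3 * y1" if "(x1, y1) \<in> S" "(x2, y2) \<in> S" for x1 y1 x2 y2
    using S that unfolding pell_cluster_def by blast
  have inj: "inj_on cls S"
  proof (rule inj_onI, clarify)
    fix x1 y1 x2 y2
    assume 1: "(x1, y1) \<in> S" and 2: "(x2, y2) \<in> S" and eq: "cls (x1, y1) = cls (x2, y2)"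
    have "M dvd 2 * (x1 * y2 - x2 * y1)"
    proof (rule pell_same_class[OF assms(2) sqf])
      show "gcd (x1 * y0 - x0 * y1) M = gcd (x2 * y0 - x0 * y2) M"
        using eq by (simp add: cls_def)
    qed (use sol[OF 0] sol[OF 1] sol[OF 2] cop[OF 0] cop[OF 1] in auto)
    thus "x1 = x2 \<and> y1 = y2"
      using pell_spacing[OF assms(1,2)] sol[OF 1] sol[OF 2] close[OF 1 2] close[OF 2 1] by blast
  qed
  moreover have "cls ` S \<subseteq> pos_divisors M"
    using assms(2) by (auto simp: cls_def pos_divisors_def)
  ultimately show ?thesis
    using finite_pos_divisors[OF assms(2)] card_inj_on_le inj_on_finite by metis
qed simp

text \<open>Sorting the points by \<open>g = gcd x y\<close>, a divisor of \<open>M\<close>, and dividing by \<open>g\<close> gives primitive points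
  on the conic with right-hand side \<open>M / g^2\<close>.\<close>

lemma pell_cluster_squarefree:
  assumes "D > 0" "M > 0"
    and sqf: "\<And>k. k > 0 \<Longrightarrow> k\<^sup>2 dvd D \<Longrightarrow> k\<^sup>2 dvd M \<Longrightarrow> k = 1"
    and S: "pell_cluster D M S"
  shows "finite S \<and> card S \<le> (card (pos_divisors M))\<^sup>2"
proof -
  define P where "P = (\<lambda>g. {(x, y). (g * x, g * y) \<in> S \<and> coprime x y})"
  define sc :: "int \<Rightarrow> int \<times> int \<Rightarrow> int \<times> int" where "sc = (\<lambda>g (x, y). (g * x, g * y))"
  let ?G = "pos_divisors M"
  have sol: "x > 0 \<and> y > 0 \<and> x\<^sup>2 - D * y\<^sup>2 = M" if "(x, y) \<in> S" for x y
    using S that unfolding pell_cluster_def by blast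
  have close: "2 * y2 \<le> 3 * y1" if "(x1, y1) \<in> S" "(x2, y2) \<in> S" for x1 y1 x2 y2
    using S that unfolding pell_cluster_def by blast
  have piece: "finite (P g) \<and> card (P g) \<le> card ?G" if "g \<in> ?G" for g
  proof (cases "P g = {}")
    case False
    have g0: "g > 0" using that by (simp add: pos_divisors_def)
    have mem: "(g * x, g * y) \<in> S" if "(x, y) \<in> P g" for x y
      using that by (simp add: P_def)
    have eqM: "g\<^sup>2 * (x\<^sup>2 - D * y\<^sup>2) = M" if "(x, y) \<in> P g" for x y
    proof -
      have "g\<^sup>2 * (x\<^sup>2 - D * y\<^sup>2) = (g * x)\<^sup>2 - D * (g * y)\<^sup>2"
        by (simp add: power2_eq_square algebra_simps)
      thus ?thesis using sol[OF mem[OF that]] by simp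
    qed
    obtain x1 y1 where "(x1, y1) \<in> P g" using False by auto
    then obtain M' where M': "M = g\<^sup>2 * M'" using eqM[of x1 y1] by metis
    have M'0: "M' > 0" using assms(2) g0 M' by (simp add: zero_less_mult_iff)
    have clu: "pell_cluster D M' (P g)"
    proof (rule pell_clusterI)
      fix x y assume xy: "(x, y) \<in> P g"
      have "x\<^sup>2 - D * y\<^sup>2 = M'" using eqM[OF xy] g0 M' by simp
      thus "x > 0 \<and> y > 0 \<and> x\<^sup>2 - D * y\<^sup>2 = M'"
        using sol[OF mem[OF xy]] g0 by (simp add: zero_less_mult_iff)
    next
      fix x1 y1 x2 y2 assume 1: "(x1, y1) \<in> P g" and 2: "(x2, y2) \<in> P g"
      have "g * (2 * y2) \<le> g * (3 * y1)" using close[OF mem[OF 1] mem[OF 2]] by simp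
      thus "2 * y2 \<le> 3 * y1" using g0 by simp
    qed
    have "k = 1" if "k > 0" "k\<^sup>2 dvd D" "k\<^sup>2 dvd M'" for k
      using that sqf[of k] M' by simp
    hence "finite (P g) \<and> card (P g) \<le> card (pos_divisors M')"
      using pell_cluster_primitive[OF assms(1) M'0 _ clu] by (auto simp: P_def)
    moreover have "card (pos_divisors M') \<le> card ?G"
      using pos_divisors_mono[of M' M] finite_pos_divisors[OF assms(2)] M' by (simp add: card_mono)
    ultimately show ?thesis by linarith
  qed simp
  have fG: "finite ?G" using finite_pos_divisors[OF assms(2)] .
  have sub: "S \<subseteq> (\<Union>g\<in>?G. sc g ` P g)"
  proof (clarify)
    fix x y assume xy: "(x, y) \<in> S"
    define g where "g = gcd x y"
    obtain x' y' where x': "x = g * x'" "y = g * y'"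
      by (metis g_def gcd_dvd1 gcd_dvd2 dvdE)
    have g0: "g > 0" using sol[OF xy] by (simp add: g_def)
    have "g * gcd x' y' = g" using g0 unfolding x' using g_def x'
      by (metis abs_of_pos gcd_mult_distrib_int)
    hence "coprime x' y'" using g0 by (simp add: coprime_iff_gcd_eq_1)
    hence "(x', y') \<in> P g" using xy x' by (simp add: P_def)
    moreover have "g dvd M"
    proof -
      have "M = x * x - D * (y * y)" using sol[OF xy] by (simp add: power2_eq_square)
      thus ?thesis using x' by (metis dvd_diff dvd_mult dvd_triv_left)
    qed
    hence "g \<in> ?G" using g0 by (simp add: pos_divisors_def)
    ultimately show "(x, y) \<in> (\<Union>g\<in>?G. sc g ` P g)"
      using x' by (force simp: sc_def)
  qed
  have fin: "finite (\<Union>g\<in>?G. sc g ` P g)" using fG piece by blast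
  have "card S \<le> card (\<Union>g\<in>?G. sc g ` P g)" by (rule card_mono[OF fin sub])
  also have "\<dots> \<le> (\<Sum>g\<in>?G. card (sc g ` P g))" by (rule card_UN_le[OF fG])
  also have "\<dots> \<le> (\<Sum>g\<in>?G. card ?G)"
    using piece by (intro sum_mono) (meson card_image_le le_trans)
  also have "\<dots> = (card ?G)\<^sup>2" by (simp add: power2_eq_square)
  finally show ?thesis using finite_subset[OF sub fin] by blast
qed

text \<open>A square \<open>s^2\<close> dividing both \<open>D\<close> and \<open>M\<close> forces \<open>s dvd x\<close>, so the largest such square can be
  removed from the equation.  It is removed all at once rather than counted over, which keeps the
  bound at the square of the number of divisors.\<close>

lemma pell_cluster_card:
  assumes "D > 0" "M > 0" and S: "pell_cluster D M S"
  shows "finite S" "card S \<le> (divisor_count (nat M))\<^sup>2"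
proof -
  define Q where "Q = {s::int. s > 0 \<and> s\<^sup>2 dvd D \<and> s\<^sup>2 dvd M}"
  have "Q \<subseteq> pos_divisors M"
    by (auto simp: Q_def pos_divisors_def power2_eq_square dest: dvd_mult_left)
  hence finQ: "finite Q" using finite_pos_divisors[OF assms(2)] finite_subset by blast
  have "1 \<in> Q" by (simp add: Q_def)
  define s where "s = Max Q"
  have "s \<in> Q" unfolding s_def using finQ \<open>1 \<in> Q\<close> by (intro Max_in) auto
  then obtain D' M' where s0: "s > 0" and D': "D = s\<^sup>2 * D'" and M': "M = s\<^sup>2 * M'"
    by (auto simp: Q_def elim!: dvdE)
  have pos: "D' > 0" "M' > 0" using assms(1,2) s0 D' M' by (simp_all add: zero_less_mult_iff)
  have sqf: "k = 1" if k: "k > 0" "k\<^sup>2 dvd D'" "k\<^sup>2 dvd M'" for k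
  proof -
    have "s * k \<in> Q" using k s0 D' M' by (simp add: Q_def power_mult_distrib)
    hence "s * k \<le> s * 1" unfolding s_def using finQ by simp
    hence "k \<le> 1" using s0 by (simp only: mult_le_cancel_left_pos)
    thus ?thesis using k(1) by simp
  qed
  define S' where "S' = {(x, y). (s * x, y) \<in> S}"
  have sol: "x > 0 \<and> y > 0 \<and> x\<^sup>2 - D * y\<^sup>2 = M" if "(x, y) \<in> S" for x y
    using S that unfolding pell_cluster_def by blast
  have clu: "pell_cluster D' M' S'"
  proof (rule pell_clusterI)
    fix x y assume "(x, y) \<in> S'"
    hence xy: "s * x > 0 \<and> y > 0 \<and> (s * x)\<^sup>2 - D * y\<^sup>2 = M" using sol by (simp add: S'_def)
    have "s\<^sup>2 * (x\<^sup>2 - D' * y\<^sup>2) = s\<^sup>2 * M'"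
      using xy D' M' by (simp add: algebra_simps power_mult_distrib)
    hence "x\<^sup>2 - D' * y\<^sup>2 = M'" using s0 by simp
    thus "x > 0 \<and> y > 0 \<and> x\<^sup>2 - D' * y\<^sup>2 = M'"
      using xy s0 by (simp add: zero_less_mult_iff)
  next
    fix x1 y1 x2 y2 assume "(x1, y1) \<in> S'" "(x2, y2) \<in> S'"
    thus "2 * y2 \<le> 3 * y1" using S unfolding pell_cluster_def S'_def by blast
  qed
  have fc: "finite S'" "card S' \<le> (card (pos_divisors M'))\<^sup>2"
    using pell_cluster_squarefree[OF pos sqf clu] by auto
  have sub: "S \<subseteq> (\<lambda>(x, y). (s * x, y)) ` S'"
  proof (clarify)
    fix x y assume xy: "(x, y) \<in> S"
    have "x\<^sup>2 = s\<^sup>2 * (M' + D' * y\<^sup>2)" using sol[OF xy] D' M' by (simp add: algebra_simps)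
    hence "s\<^sup>2 dvd x\<^sup>2" by simp
    hence "s dvd x" by simp
    then obtain x' where "x = s * x'" by blast
    thus "(x, y) \<in> (\<lambda>(x, y). (s * x, y)) ` S'" using xy by (force simp: S'_def)
  qed
  show "finite S" using sub fc(1) finite_subset by blast
  have "card S \<le> card S'" using sub fc(1) surj_card_le by blast
  also note fc(2)
  also have "card (pos_divisors M') \<le> card (pos_divisors M)"
    using pos_divisors_mono[of M' M] finite_pos_divisors[OF assms(2)] M' by (simp add: card_mono)
  hence "(card (pos_divisors M'))\<^sup>2 \<le> (card (pos_divisors M))\<^sup>2" by (rule power_mono) simp
  also have "card (pos_divisors M) = divisor_count (nat M)" by (rule card_pos_divisors[OF assms(2)])
  finally show "card S \<le> (divisor_count (nat M))\<^sup>2" .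
qed

section \<open>Equal sums of two cubes in a short interval\<close>

text \<open>The sums \<open>b = n3 + n4\<close> and \<open>b + h = n1 + n2\<close> and the differences \<open>d\<close>, \<open>c\<close> of a nontrivial
  coincidence \<open>n1^3 + n2^3 = n3^3 + n4^3\<close>, with the auxiliary quotient \<open>m\<close>.\<close>
definition colliding_sum :: "int \<Rightarrow> int \<Rightarrow> int \<Rightarrow> int \<Rightarrow> int \<Rightarrow> int \<Rightarrow> bool" where
  "colliding_sum H b h m c d \<longleftrightarrow>
     0 < h \<and> 0 < m \<and> 0 < c \<and> c \<le> H \<and> 0 < d \<and> d \<le> H \<and>
     3 * b * m = h * (h\<^sup>2 + 3 * c\<^sup>2) \<and> d\<^sup>2 = c\<^sup>2 + h\<^sup>2 + b * h + m"

text \<open>If the sums of the bases agree as well, so do their products, since the difference of the two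
  sides factors as \<open>3 (n1 + n2) (n3 - n1) (n3 - n2)\<close>.\<close>

lemma cubes_eq_same_sum:
  fixes n1 n2 n3 n4 :: int
  assumes "n1 > 0" "n2 > 0" "n1 + n2 = n3 + n4" "n1 ^ 3 + n2 ^ 3 = n3 ^ 3 + n4 ^ 3"
  shows "{n1, n2} = {n3, n4}"
proof -
  have n4: "n4 = n1 + n2 - n3" using assms(3) by simp
  have "n3 ^ 3 + (n1 + n2 - n3) ^ 3 - n1 ^ 3 - n2 ^ 3 = 3 * (n1 + n2) * ((n3 - n1) * (n3 - n2))"
    by (simp add: power2_eq_square power3_eq_cube algebra_simps)
  also have "n3 ^ 3 + (n1 + n2 - n3) ^ 3 - n1 ^ 3 - n2 ^ 3 = 0" using assms(4) unfolding n4 by simp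
  finally have "3 * (n1 + n2) * ((n3 - n1) * (n3 - n2)) = 0" by (rule sym)
  hence "n3 = n1 \<or> n3 = n2" using assms(1,2) unfolding mult_eq_0_iff by auto
  thus ?thesis using n4 by auto
qed

text \<open>The equation of cubes, multiplied by four, is \<open>(b + h)^3 + 3 (b + h) c^2 = b^3 + 3 b d^2\<close>.
  The bound on \<open>h\<close> serves only to exclude \<open>c = 0\<close>: this would give \<open>3 b m = h^3\<close>, although \<open>h^3\<close>
  is smaller than \<open>3 b\<close>.\<close>

lemma cubes_collision_params:
  fixes n1 n2 n3 n4 N X H :: int
  assumes X: "0 < X" "X \<le> N"
    and n: "\<And>n. n \<in> {n1, n2, n3, n4} \<Longrightarrow> N \<le> n \<and> n \<le> N + H"
    and small: "\<And>h. h > 0 \<Longrightarrow> 2 * X * h \<le> H\<^sup>2 \<Longrightarrow> h ^ 3 < 6 * X"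
    and eq: "n1 ^ 3 + n2 ^ 3 = n3 ^ 3 + n4 ^ 3"
    and gt: "n3 + n4 < n1 + n2"
  shows "\<exists>h m c d. colliding_sum H (n3 + n4) h m c d"
proof -
  define b h c d where "b = n3 + n4" and "h = n1 + n2 - b" and "c = \<bar>n1 - n2\<bar>" and "d = \<bar>n3 - n4\<bar>"
  define m where "m = d\<^sup>2 - c\<^sup>2 - h\<^sup>2 - b * h"
  have b: "2 * X \<le> b" using n[of n3] n[of n4] X by (simp add: b_def)
  have h: "h > 0" using gt by (simp add: h_def b_def)
  have cd: "0 \<le> c" "c \<le> H" "0 \<le> d" "d \<le> H"
    using n[of n1] n[of n2] n[of n3] n[of n4] by (auto simp: c_def d_def abs_le_iff)
  have abs2: "c\<^sup>2 = (n1 - n2)\<^sup>2" "d\<^sup>2 = (n3 - n4)\<^sup>2" by (simp_all add: c_def d_def)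
  have "4 * (n1 ^ 3 + n2 ^ 3) = (b + h) ^ 3 + 3 * (b + h) * c\<^sup>2"
    unfolding abs2 h_def by (simp add: power2_eq_square power3_eq_cube algebra_simps)
  moreover have "4 * (n3 ^ 3 + n4 ^ 3) = b ^ 3 + 3 * b * d\<^sup>2"
    unfolding abs2 b_def by (simp add: power2_eq_square power3_eq_cube algebra_simps)
  ultimately have "(b + h) ^ 3 + 3 * (b + h) * c\<^sup>2 = b ^ 3 + 3 * b * d\<^sup>2" using eq by simp
  hence main: "3 * b * m = h * (h\<^sup>2 + 3 * c\<^sup>2)"
    unfolding m_def by (simp add: power2_eq_square power3_eq_cube algebra_simps)
  have "h * (h\<^sup>2 + 3 * c\<^sup>2) > 0" using h by (simp add: add_pos_nonneg)
  hence m: "m > 0" using main b X by (metis less_le_trans mult_pos_pos zero_less_mult_pos zero_less_numeral)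
  have d2: "d\<^sup>2 = c\<^sup>2 + h\<^sup>2 + b * h + m" by (simp add: m_def)
  have bh: "2 * X * h \<le> b * h" using b h by simp
  have "0 < 2 * X * h" using X(1) h by simp
  hence "d\<^sup>2 > 0" using d2 bh m zero_le_power2[of c] zero_le_power2[of h] by linarith
  hence d0: "d > 0" using cd by auto
  have "c \<noteq> 0"
  proof
    assume "c = 0"
    hence "3 * (b * m) = h ^ 3" using main by (simp add: power2_eq_square power3_eq_cube)
    moreover have "d\<^sup>2 \<le> H\<^sup>2" using cd by (intro power_mono) auto
    hence "2 * X * h \<le> H\<^sup>2" using d2 bh m zero_le_power2[of c] zero_le_power2[of h] by linarith
    hence "h ^ 3 < 6 * X" using small h by blast
    moreover have "b * 1 \<le> b * m" using b X m by (intro mult_left_mono) auto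
    ultimately show False using b by linarith
  qed
  hence "c > 0" using cd by simp
  thus ?thesis using h m d0 cd main d2 unfolding colliding_sum_def b_def by blast
qed

text \<open>The chain \<open>b h \<le> d^2 \<le> H^2\<close> bounds \<open>h\<close>, and inserting this into \<open>3 b m = h (h^2 + 3 c^2)\<close> bounds
  \<open>m\<close>.  The two cruder bounds in terms of \<open>X\<close> alone control the size of the number whose divisors
  are counted.\<close>

lemma colliding_sum_bounds:
  assumes "colliding_sum H b h m c d" and X: "0 < X" "2 * X \<le> b" "H \<le> X"
  shows "2 * X * h \<le> H\<^sup>2" "3 * X\<^sup>2 * m \<le> H ^ 4" "h \<le> X" "m \<le> X\<^sup>2"
proof -
  note C = assms(1)[unfolded colliding_sum_def]
  have H0: "H > 0" using C by linarith
  have "2 * X * h \<le> b * h" using X C by (intro mult_right_mono) auto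
  also have "\<dots> \<le> d\<^sup>2" using C zero_le_power2[of c] zero_le_power2[of h] by linarith
  also have "\<dots> \<le> H\<^sup>2" using C by (intro power_mono) auto
  finally show h: "2 * X * h \<le> H\<^sup>2" .
  have "H * H \<le> X * H" using X H0 by (intro mult_right_mono) auto
  hence "X * (2 * h) \<le> X * H" using h by (simp add: power2_eq_square)
  hence h2: "2 * h \<le> H" using X(1) by (simp only: mult_le_cancel_left_pos)
  thus "h \<le> X" using X C by linarith
  have "h\<^sup>2 \<le> H\<^sup>2" "c\<^sup>2 \<le> H\<^sup>2" using h2 C by (auto intro!: power_mono)
  hence hc: "h\<^sup>2 + 3 * c\<^sup>2 \<le> 4 * H\<^sup>2" by linarith
  have "6 * X * m \<le> 3 * b * m" using X C by (intro mult_right_mono) auto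
  also have "\<dots> \<le> h * (4 * H\<^sup>2)" using C hc by simp
  finally have "6 * X * m \<le> h * (4 * H\<^sup>2)" .
  hence "(2 * X) * (6 * X * m) \<le> (2 * X) * (h * (4 * H\<^sup>2))" using X(1) by (intro mult_left_mono) auto
  also have "\<dots> = (2 * X * h) * (4 * H\<^sup>2)" by (simp add: ac_simps)
  also have "\<dots> \<le> H\<^sup>2 * (4 * H\<^sup>2)" using h by (intro mult_right_mono) auto
  finally have "4 * (3 * X\<^sup>2 * m) \<le> 4 * H ^ 4" by (simp add: power2_eq_square power4_eq_xxxx ac_simps)
  thus m: "3 * X\<^sup>2 * m \<le> H ^ 4" by (simp only: mult_le_cancel_left_pos zero_less_numeral)
  have "H ^ 4 \<le> X ^ 4" using X H0 by (intro power_mono) auto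
  moreover have "X\<^sup>2 * m \<le> 3 * X\<^sup>2 * m" using C by simp
  ultimately have "X\<^sup>2 * m \<le> X ^ 4" using m by linarith
  hence "X\<^sup>2 * m \<le> X\<^sup>2 * X\<^sup>2" by (simp add: power2_eq_square power4_eq_xxxx ac_simps)
  thus "m \<le> X\<^sup>2" by (rule mult_left_le_imp_le) (use X(1) in simp)
qed

text \<open>Multiplying \<open>d^2 = c^2 + h^2 + b h + m\<close> by \<open>9 m^2\<close> turns the term with \<open>b\<close> into one with the
  product \<open>3 b m\<close>, which is known in terms of \<open>h\<close> and \<open>c\<close>.\<close>

lemma colliding_sum_pell:
  assumes "colliding_sum H b h m c d"
  shows "(3 * m * d)\<^sup>2 - 9 * m * (m + h\<^sup>2) * c\<^sup>2 = 3 * m * (3 * m\<^sup>2 + 3 * m * h\<^sup>2 + h ^ 4)"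
proof -
  note C = assms[unfolded colliding_sum_def]
  have d2: "d\<^sup>2 = c\<^sup>2 + h\<^sup>2 + b * h + m" and b: "3 * b * m = h * (h\<^sup>2 + 3 * c\<^sup>2)" using C by auto
  have "(3 * m * d)\<^sup>2 = 9 * m\<^sup>2 * d\<^sup>2" by (simp add: power_mult_distrib)
  also have "\<dots> = 9 * m\<^sup>2 * (c\<^sup>2 + h\<^sup>2 + m) + 3 * m * h * (3 * b * m)"
    unfolding d2 by (simp add: power2_eq_square algebra_simps)
  also have "\<dots> = 9 * m\<^sup>2 * (c\<^sup>2 + h\<^sup>2 + m) + 3 * m * h * (h * (h\<^sup>2 + 3 * c\<^sup>2))" unfolding b ..
  finally show ?thesis by (simp add: power2_eq_square power4_eq_xxxx algebra_simps)
qed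

text \<open>Since \<open>3 h c^2 = 3 b m - h^3\<close>, the ratio of \<open>c2^2\<close> to \<open>c1^2\<close> is close to \<open>b2 / b1\<close>, hence barely
  above \<open>2\<close> at worst.  This leaves room below \<open>(3/2)^2\<close> for the error terms \<open>H\<close> and \<open>h^3\<close>.\<close>

lemma colliding_sum_close:
  fixes X H b1 b2 h m c1 c2 :: int
  assumes C1: "colliding_sum H b1 h m c1 d1" and C2: "colliding_sum H b2 h m c2 d2"
    and b: "2 * X \<le> b1" "b2 \<le> 4 * X + 2 * H" and small: "24 * H + 5 * h ^ 3 \<le> 6 * X"
  shows "2 * c2 \<le> 3 * c1"
proof -
  note C = C1[unfolded colliding_sum_def] C2[unfolded colliding_sum_def]
  have e1: "3 * h * c1\<^sup>2 = 3 * b1 * m - h ^ 3" and e2: "3 * h * c2\<^sup>2 = 3 * b2 * m - h ^ 3"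
    using C by (simp_all add: algebra_simps power2_eq_square power3_eq_cube)
  have "0 < h ^ 3" using C by simp
  have "h ^ 3 * 1 \<le> h ^ 3 * m" using C \<open>0 < h ^ 3\<close> by (intro mult_left_mono) auto
  have "12 * b2 + 5 * h ^ 3 \<le> 27 * b1" using b small by linarith
  hence "(12 * b2 + 5 * h ^ 3) * m \<le> (27 * b1) * m" using C by (intro mult_right_mono) auto
  hence "4 * (3 * b2 * m - h ^ 3) \<le> 9 * (3 * b1 * m - h ^ 3)"
    using \<open>h ^ 3 * 1 \<le> _\<close> by (simp add: algebra_simps)
  hence "(3 * h) * (4 * c2\<^sup>2) \<le> (3 * h) * (9 * c1\<^sup>2)"
    unfolding e1[symmetric] e2[symmetric] by (simp only: mult_ac)
  hence "4 * c2\<^sup>2 \<le> 9 * c1\<^sup>2" by (rule mult_left_le_imp_le) (use C in simp)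
  hence "(2 * c2)\<^sup>2 \<le> (3 * c1)\<^sup>2" by (simp add: power_mult_distrib)
  thus ?thesis by (rule power2_le_imp_le) (use C in simp)
qed

text \<open>There are at most \<open>H^2 / (2 X)\<close> values of \<open>h\<close> and \<open>H^4 / (3 X^2)\<close> values of \<open>m\<close>; for fixed \<open>h\<close> and
  \<open>m\<close> the possible points \<open>(3 m d, c)\<close> form a cluster on one conic, and \<open>c\<close> determines
  \<open>b\<close>.\<close>

lemma card_colliding_sums:
  fixes X H :: int and T :: nat
  assumes X: "0 < X" "0 \<le> H" "H \<le> X"
    and small: "\<And>h. h > 0 \<Longrightarrow> 2 * X * h \<le> H\<^sup>2 \<Longrightarrow> 24 * H + 5 * h ^ 3 \<le> 6 * X"
    and T: "\<And>M. 0 < M \<Longrightarrow> M \<le> 21 * X ^ 6 \<Longrightarrow> divisor_count (nat M) \<le> T"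
  defines "B \<equiv> {b. 2 * X \<le> b \<and> b \<le> 4 * X + 2 * H \<and> (\<exists>h m c d. colliding_sum H b h m c d)}"
  shows "finite B"
    and "card B \<le> nat (H\<^sup>2 div (2 * X)) * nat (H ^ 4 div (3 * X\<^sup>2)) * T\<^sup>2"
proof -
  show fin: "finite B" by (rule finite_subset[of _ "{2 * X..4 * X + 2 * H}"]) (auto simp: B_def)
  let ?P = "{1..H\<^sup>2 div (2 * X)} \<times> {1..H ^ 4 div (3 * X\<^sup>2)}"
  define S where "S = (\<lambda>(h, m). {(x, c). \<exists>b d. x = 3 * m * d \<and> b \<in> B \<and> colliding_sum H b h m c d})"
  define f where "f = (\<lambda>(h::int, m). \<lambda>(x::int, c). h * (h\<^sup>2 + 3 * c\<^sup>2) div (3 * m))"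
  have S: "finite (S p) \<and> card (S p) \<le> T\<^sup>2" for p
  proof (cases "S p = {}")
    case False
    obtain h m where p: "p = (h, m)" by fastforce
    then obtain b0 c0 d0 where 0: "b0 \<in> B" "colliding_sum H b0 h m c0 d0"
      using False by (auto simp: S_def)
    let ?D = "9 * m * (m + h\<^sup>2)" and ?M = "3 * m * (3 * m\<^sup>2 + 3 * m * h\<^sup>2 + h ^ 4)"
    have hm: "h > 0" "m > 0" using 0 by (simp_all add: colliding_sum_def)
    have bd: "2 * X * h \<le> H\<^sup>2" "h \<le> X" "m \<le> X\<^sup>2"
      using colliding_sum_bounds[OF 0(2) X(1) _ X(3)] 0(1) by (auto simp: B_def)
    have pos: "?D > 0" "?M > 0" using hm by (auto intro!: mult_pos_pos add_pos_pos)
    have MX: "?M \<le> 21 * X ^ 6"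
    proof -
      have h2: "h\<^sup>2 \<le> X\<^sup>2" using bd hm by (intro power_mono) auto
      have "m\<^sup>2 \<le> (X\<^sup>2)\<^sup>2" using bd hm by (intro power_mono) auto
      moreover have "m * h\<^sup>2 \<le> X\<^sup>2 * X\<^sup>2" using bd hm h2 by (intro mult_mono) auto
      moreover have "h ^ 4 \<le> X ^ 4" using bd hm by (intro power_mono) auto
      ultimately have "3 * m\<^sup>2 + 3 * m * h\<^sup>2 + h ^ 4 \<le> 7 * X ^ 4"
        by (simp add: power2_eq_square power4_eq_xxxx ac_simps)
      hence "?M \<le> 3 * X\<^sup>2 * (7 * X ^ 4)" using bd hm by (intro mult_mono) auto
      also have "\<dots> = 21 * X ^ 6" by (simp flip: power_add)
      finally show ?thesis .
    qed
    have "pell_cluster ?D ?M (S p)"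
    proof (rule pell_clusterI)
      fix x y assume "(x, y) \<in> S p"
      then obtain b d where bd: "x = 3 * m * d" "colliding_sum H b h m y d"
        by (auto simp: S_def p)
      thus "x > 0 \<and> y > 0 \<and> x\<^sup>2 - ?D * y\<^sup>2 = ?M"
        using colliding_sum_pell[OF bd(2)] by (simp add: colliding_sum_def)
    next
      fix x1 y1 x2 y2 assume "(x1, y1) \<in> S p" "(x2, y2) \<in> S p"
      then obtain b1 d1 b2 d2 where 1: "b1 \<in> B" "colliding_sum H b1 h m y1 d1"
        and 2: "b2 \<in> B" "colliding_sum H b2 h m y2 d2"
        by (auto simp: S_def p)
      show "2 * y2 \<le> 3 * y1"
        using colliding_sum_close[OF 1(2) 2(2) _ _ small[OF hm(1) bd(1)]] 1(1) 2(1)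
        by (auto simp: B_def)
    qed
    hence "finite (S p)" "card (S p) \<le> (divisor_count (nat ?M))\<^sup>2"
      using pell_cluster_card[OF pos] by blast+
    moreover have "(divisor_count (nat ?M))\<^sup>2 \<le> T\<^sup>2"
      using T[OF pos(2) MX] by (intro power_mono) auto
    ultimately show ?thesis by linarith
  qed simp
  have sub: "B \<subseteq> (\<Union>p\<in>?P. f p ` S p)"
  proof
    fix b assume b: "b \<in> B"
    then obtain h m c d where C: "colliding_sum H b h m c d" by (auto simp: B_def)
    note bd = colliding_sum_bounds[OF C X(1) _ X(3)]
    have hm: "h > 0" "m > 0" using C by (simp_all add: colliding_sum_def)
    have "h \<le> H\<^sup>2 div (2 * X)" "m \<le> H ^ 4 div (3 * X\<^sup>2)"
      using bd(1,2) b X(1) zdiv_mono1[of "2 * X * h" "H\<^sup>2" "2 * X"]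
        zdiv_mono1[of "3 * X\<^sup>2 * m" "H ^ 4" "3 * X\<^sup>2"] by (auto simp: B_def)
    hence "(h, m) \<in> ?P" using hm by simp
    moreover have "(3 * m * d, c) \<in> S (h, m)" using b C by (auto simp: S_def)
    moreover have "f (h, m) (3 * m * d, c) = b"
    proof -
      have "h * (h\<^sup>2 + 3 * c\<^sup>2) = b * (3 * m)" using C by (simp add: colliding_sum_def mult_ac)
      thus ?thesis using hm by (simp add: f_def)
    qed
    ultimately have "b \<in> f (h, m) ` S (h, m)" by (intro image_eqI) auto
    thus "b \<in> (\<Union>p\<in>?P. f p ` S p)" using \<open>(h, m) \<in> ?P\<close> by (rule UN_I[rotated])
  qed
  have "card B \<le> card (\<Union>p\<in>?P. f p ` S p)"
    using sub S by (intro card_mono) auto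
  also have "\<dots> \<le> (\<Sum>p\<in>?P. card (f p ` S p))" by (intro card_UN_le) simp
  also have "\<dots> \<le> (\<Sum>p\<in>?P. T\<^sup>2)"
    using S by (intro sum_mono) (meson card_image_le le_trans)
  also have "\<dots> = nat (H\<^sup>2 div (2 * X)) * nat (H ^ 4 div (3 * X\<^sup>2)) * T\<^sup>2"
    by (simp add: card_cartesian_product)
  finally show "card B \<le> nat (H\<^sup>2 div (2 * X)) * nat (H ^ 4 div (3 * X\<^sup>2)) * T\<^sup>2" .
qed

section \<open>A starting point without coincidences\<close>

text \<open>A coincidence inside \<open>[N, N + H]\<close> has \<open>2 N \<le> b \<le> 2 N + 2 H\<close>, so each \<open>b\<close> rules out at most
  \<open>H + 1\<close> values of \<open>N\<close>.  If altogether fewer than \<open>X\<close> values are ruled out, one of the \<open>X\<close>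
  candidates is left.\<close>

lemma exists_sidon_interval:
  fixes X H :: int and T :: nat
  assumes X: "0 < X" "0 \<le> H" "H \<le> X"
    and small: "\<And>h. h > 0 \<Longrightarrow> 2 * X * h \<le> H\<^sup>2 \<Longrightarrow> 24 * H + 5 * h ^ 3 \<le> 6 * X"
    and T: "\<And>M. 0 < M \<Longrightarrow> M \<le> 21 * X ^ 6 \<Longrightarrow> divisor_count (nat M) \<le> T"
    and few: "nat (H + 1) * (nat (H\<^sup>2 div (2 * X)) * nat (H ^ 4 div (3 * X\<^sup>2)) * T\<^sup>2) < nat X"
  shows "\<exists>N. X \<le> N \<and> N < 2 * X \<and> sidon_set ((\<lambda>n. n ^ 3) ` {N..N + H})"
proof -
  define B where
    "B = {b. 2 * X \<le> b \<and> b \<le> 4 * X + 2 * H \<and> (\<exists>h m c d. colliding_sum H b h m c d)}"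
  have B: "finite B" "card B \<le> nat (H\<^sup>2 div (2 * X)) * nat (H ^ 4 div (3 * X\<^sup>2)) * T\<^sup>2"
    unfolding B_def using card_colliding_sums[OF X small T] by blast+
  define near where "near = (\<lambda>b. {N::int. 2 * N \<le> b \<and> b \<le> 2 * N + 2 * H})"
  have near: "finite (near b) \<and> card (near b) \<le> nat (H + 1)" for b
  proof -
    have "near b \<subseteq> {b div 2 - H..b div 2}" by (auto simp: near_def)
    moreover have "card {b div 2 - H..b div 2} = nat (H + 1)" by simp
    ultimately show ?thesis by (metis card_mono finite_atLeastAtMost_int finite_subset)
  qed
  have "card (\<Union>b\<in>B. near b) \<le> (\<Sum>b\<in>B. card (near b))" by (rule card_UN_le[OF B(1)])
  also have "\<dots> \<le> card B * nat (H + 1)" using near by (intro sum_bounded_above[THEN order_trans]) auto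
  also have "\<dots> \<le> nat (H + 1) * (nat (H\<^sup>2 div (2 * X)) * nat (H ^ 4 div (3 * X\<^sup>2)) * T\<^sup>2)"
    using B(2) by (simp add: mult.commute)
  also have "\<dots> < card {X..<2 * X}" using few by simp
  finally have "\<not> {X..<2 * X} \<subseteq> (\<Union>b\<in>B. near b)"
    using B(1) near by (meson card_mono finite_UN_I not_le)
  then obtain N where N: "X \<le> N" "N < 2 * X" "\<And>b. b \<in> B \<Longrightarrow> N \<notin> near b"
    by (auto simp: subset_iff)
  have no_gt: False
    if n: "\<And>n. n \<in> {n1, n2, n3, n4} \<Longrightarrow> N \<le> n \<and> n \<le> N + H"
      and eq: "n1 ^ 3 + n2 ^ 3 = n3 ^ 3 + n4 ^ 3" and gt: "n3 + n4 < n1 + n2" for n1 n2 n3 n4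
  proof -
    have "h ^ 3 < 6 * X" if "h > 0" "2 * X * h \<le> H\<^sup>2" for h
      using small[OF that] X(2) that(1) zero_less_power[of h 3] by linarith
    hence "\<exists>h m c d. colliding_sum H (n3 + n4) h m c d"
      using cubes_collision_params[OF X(1) N(1) n _ eq gt] by blast
    moreover have "2 * N \<le> n3 + n4" "n3 + n4 \<le> 2 * N + 2 * H" using n[of n3] n[of n4] by auto
    ultimately have "n3 + n4 \<in> B" "N \<in> near (n3 + n4)"
      using N(1,2) by (auto simp: B_def near_def)
    thus False using N(3) by blast
  qed
  have "sidon_set ((\<lambda>n. n ^ 3) ` {N..N + H})"
    unfolding sidon_set_def
  proof (intro ballI impI)
    fix a1 a2 a3 a4
    assume "a1 \<in> (\<lambda>n. n ^ 3) ` {N..N + H}" "a2 \<in> (\<lambda>n. n ^ 3) ` {N..N + H}"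
      "a3 \<in> (\<lambda>n. n ^ 3) ` {N..N + H}" "a4 \<in> (\<lambda>n. n ^ 3) ` {N..N + H}" and eq: "a1 + a2 = a3 + a4"
    then obtain n1 n2 n3 n4 where a: "a1 = n1 ^ 3" "a2 = n2 ^ 3" "a3 = n3 ^ 3" "a4 = n4 ^ 3"
      and n: "n1 \<in> {N..N + H}" "n2 \<in> {N..N + H}" "n3 \<in> {N..N + H}" "n4 \<in> {N..N + H}" by blast
    have eq': "n1 ^ 3 + n2 ^ 3 = n3 ^ 3 + n4 ^ 3" using eq a by simp
    have "\<not> n3 + n4 < n1 + n2" using no_gt[of n1 n2 n3 n4] n eq' by auto
    moreover have "\<not> n1 + n2 < n3 + n4" using no_gt[of n3 n4 n1 n2] n eq' by auto
    ultimately have "n1 + n2 = n3 + n4" by simp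
    hence "{n1, n2} = {n3, n4}" using cubes_eq_same_sum[OF _ _ _ eq'] n N(1) X(1) by auto
    thus "{a1, a2} = {a3, a4}" unfolding a by (auto simp: doubleton_eq_iff)
  qed
  thus ?thesis using N(1,2) by blast
qed

lemma sidon_set_subset: "sidon_set A \<Longrightarrow> B \<subseteq> A \<Longrightarrow> sidon_set B"
  unfolding sidon_set_def by blast

text \<open>The product is about \<open>H^7 T^2 / X^3\<close>.  With \<open>Z = 2 X\<close>, the bounds on \<open>H\<close> and \<open>T\<close> give
  \<open>H^7 T^2 \<le> C^2 Z powr (4 - 7 e + 6 e)\<close>: the divisors cost \<open>6 e\<close> of the \<open>7 e\<close> saved in the length
  of the interval, and the remaining factor \<open>Z powr e\<close> outgrows the constant.\<close>

lemma few_bad_starting_points: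
  fixes X :: nat and H :: int and T :: nat and e C :: real
  assumes X: "X > 0" and H: "1 \<le> H" "real_of_int H \<le> (2 * real X) powr (4/7 - e)"
    and T: "0 \<le> C" "real T \<le> C * (2 * real X) powr (3 * e)"
    and large: "16 * C\<^sup>2 < 3 * (2 * real X) powr e"
  shows "nat (H + 1) * (nat (H\<^sup>2 div (2 * int X)) * nat (H ^ 4 div (3 * (int X)\<^sup>2)) * T\<^sup>2) < X"
proof -
  define r Z h where "r = real X" and "Z = 2 * r" and "h = real_of_int H"
  have r: "r > 0" and Z: "Z > 0" and h: "h \<ge> 1" using X H by (simp_all add: r_def Z_def h_def)
  have d1: "real (nat (H\<^sup>2 div (2 * int X))) \<le> h\<^sup>2 / (2 * r)"
  proof -
    have "real_of_int (H\<^sup>2 div (2 * int X)) \<le> real_of_int (H\<^sup>2) / real_of_int (2 * int X)"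
      by (rule real_of_int_div4)
    thus ?thesis using X by (simp add: h_def r_def pos_imp_zdiv_nonneg_iff)
  qed
  have d2: "real (nat (H ^ 4 div (3 * (int X)\<^sup>2))) \<le> h ^ 4 / (3 * r\<^sup>2)"
  proof -
    have "real_of_int (H ^ 4 div (3 * (int X)\<^sup>2)) \<le> real_of_int (H ^ 4) / real_of_int (3 * (int X)\<^sup>2)"
      by (rule real_of_int_div4)
    thus ?thesis using X by (simp add: h_def r_def pos_imp_zdiv_nonneg_iff)
  qed
  have d0: "real (nat (H + 1)) \<le> 2 * h" using H(1) by (simp add: h_def)
  have H7: "h ^ 7 \<le> Z powr (4 - 7 * e)"
  proof -
    have "h ^ 7 \<le> (Z powr (4/7 - e)) ^ 7"
      using H h by (intro power_mono) (auto simp: h_def Z_def r_def)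
    also have "\<dots> = Z powr (7 * (4/7 - e))" using Z by (simp add: powr_power mult.commute)
    finally show ?thesis by (simp add: algebra_simps)
  qed
  have T2: "(real T)\<^sup>2 \<le> C\<^sup>2 * Z powr (6 * e)"
  proof -
    have "(real T)\<^sup>2 \<le> (C * Z powr (3 * e))\<^sup>2"
      using T by (intro power_mono) (auto simp: Z_def r_def)
    also have "\<dots> = C\<^sup>2 * Z powr (6 * e)"
      using Z by (simp add: power_mult_distrib powr_power)
    finally show ?thesis .
  qed
  have "h ^ 7 * (real T)\<^sup>2 \<le> Z powr (4 - 7 * e) * (C\<^sup>2 * Z powr (6 * e))"
    using H7 T2 by (intro mult_mono) auto
  also have "\<dots> = C\<^sup>2 * Z powr (4 - e)" by (simp add: powr_add[symmetric] mult_ac)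
  also have "\<dots> = C\<^sup>2 * (Z ^ 4 / Z powr e)"
    using Z by (simp add: powr_diff powr_numeral)
  also have "\<dots> = r ^ 4 * (16 * C\<^sup>2 / Z powr e)" by (simp add: Z_def power_mult_distrib)
  also have "\<dots> < r ^ 4 * 3"
    using large r Z by (intro mult_strict_left_mono) (auto simp: Z_def r_def divide_less_eq)
  finally have key: "h ^ 7 * (real T)\<^sup>2 < 3 * r ^ 4" by simp
  have "real (nat (H + 1) * (nat (H\<^sup>2 div (2 * int X)) * nat (H ^ 4 div (3 * (int X)\<^sup>2)) * T\<^sup>2))
      = real (nat (H + 1)) * (real (nat (H\<^sup>2 div (2 * int X))) *
          real (nat (H ^ 4 div (3 * (int X)\<^sup>2))) * (real T)\<^sup>2)"
    by (simp only: of_nat_mult of_nat_power)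
  also have "\<dots> \<le> (2 * h) * (h\<^sup>2 / (2 * r) * (h ^ 4 / (3 * r\<^sup>2)) * (real T)\<^sup>2)"
    using d0 d1 d2 h r by (intro mult_mono) auto
  also have "\<dots> = h ^ 7 * (real T)\<^sup>2 / (3 * r ^ 3)"
    using r by (simp add: field_simps power_numeral_reduce)
  also have "\<dots> < 3 * r ^ 4 / (3 * r ^ 3)" using key r by (intro divide_strict_right_mono) auto
  also have "\<dots> = real X" using r by (simp add: r_def power_numeral_reduce)
  finally show ?thesis by (simp only: of_nat_less_iff)
qed

theorem theorem5:
  fixes \<epsilon> :: real
  assumes "\<epsilon> > 0"
  shows "infinite {N::nat. N > 0 \<and>
           sidon_set {int n ^ 3 | n::nat.
             n > 0 \<and> N \<le> n \<and> real n \<le> real N + real N powr (4/7 - \<epsilon>)}}"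
proof -
  \<comment> \<open>Shrinking \<open>\<epsilon>\<close> only lengthens the interval; \<open>e \<le> 1/14\<close> keeps the exponent \<open>4/7 - e\<close> positive.\<close>
  define e where "e = min \<epsilon> (1/14)"
  have e: "e > 0" "e \<le> \<epsilon>" "e \<le> 1/14" using assms by (simp_all add: e_def)
  \<comment> \<open>The divisors counted belong to numbers up to \<open>Z ^ 6\<close> and the count enters squared, so the
    exponent \<open>e/2\<close> costs \<open>6 e\<close>, less than the \<open>7 e\<close> available.\<close>
  obtain C where C: "C \<ge> 1" "\<And>n. n > 0 \<Longrightarrow> real (divisor_count n) \<le> C * real n powr (e/2)"
    using divisor_bound[of "e/2"] e by auto
  have "\<exists>N>k. N > 0 \<and> sidon_set {int n ^ 3 | n::nat.
             n > 0 \<and> N \<le> n \<and> real n \<le> real N + real N powr (4/7 - \<epsilon>)}" for k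
  proof -
    \<comment> \<open>The second bound gives \<open>10 * Z powr (4/7) \<le> Z\<close>, the third \<open>16 * C^2 \<le> Z powr e\<close>.\<close>
    obtain X :: nat where "real X > max (real k) (max (10 powr (7/3)) ((16 * C\<^sup>2) powr (1/e)))"
      using reals_Archimedean2 by blast
    hence X: "k < X" "10 powr (7/3) \<le> real X" "(16 * C\<^sup>2) powr (1/e) \<le> real X" by auto
    define Z where "Z = 2 * real X"
    have Z: "Z > 0" "Z \<ge> 1" "X > 0" using X by (simp_all add: Z_def)
    have "16 * C\<^sup>2 = ((16 * C\<^sup>2) powr (1/e)) powr e" using e C by (simp add: powr_powr)
    also have "\<dots> \<le> Z powr e" using X(3) e by (intro powr_mono2) (auto simp: Z_def)
    finally have CZ: "16 * C\<^sup>2 \<le> Z powr e" .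
    have "10 = (10 powr (7/3)) powr (3/7::real)" by (simp add: powr_powr)
    also have "\<dots> \<le> Z powr (3/7)" using X(2) by (intro powr_mono2) (auto simp: Z_def)
    finally have "10 * Z powr (4/7) \<le> Z powr (3/7) * Z powr (4/7)" by (intro mult_right_mono) auto
    hence Z47: "10 * Z powr (4/7) \<le> Z" using Z by (simp add: powr_add[symmetric])
    define H where "H = \<lfloor>Z powr (4/7 - e)\<rfloor>"
    have HZ: "real_of_int H \<le> Z powr (4/7 - e)" by (simp add: H_def)
    also have "\<dots> \<le> Z powr (4/7)" using Z e by (intro powr_mono) auto
    finally have H47: "real_of_int H \<le> Z powr (4/7)" .
    have "1 \<le> Z powr (4/7 - e)" using Z e by (intro ge_one_powr_ge_zero) auto
    hence H1: "1 \<le> H" by (simp add: H_def le_floor_iff)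
    have "real_of_int H \<le> real X" using H47 Z47 Z by (simp add: Z_def)
    hence HX: "H \<le> int X" by linarith
    have small: "24 * H + 5 * h ^ 3 \<le> 6 * int X" if h: "h > 0" "2 * int X * h \<le> H\<^sup>2" for h
    proof -
      have "real_of_int (2 * int X * h) \<le> real_of_int (H\<^sup>2)" using h(2) by (simp only: of_int_le_iff)
      hence "Z * real_of_int h \<le> (real_of_int H)\<^sup>2" by (simp add: Z_def)
      also have "\<dots> \<le> (Z powr (4/7))\<^sup>2" using H47 H1 by (intro power_mono) auto
      also have "\<dots> = Z * Z powr (1/7)" using Z by (simp add: powr_power powr_mult_base)
      finally have "real_of_int h \<le> Z powr (1/7)" using Z by simp
      hence "real_of_int h ^ 3 \<le> (Z powr (1/7)) ^ 3" using h(1) by (intro power_mono) auto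
      also have "\<dots> = Z powr (3/7)" using Z by (simp add: powr_power)
      also have "\<dots> \<le> Z powr (4/7)" using Z by (intro powr_mono) auto
      finally have "24 * real_of_int H + 5 * real_of_int h ^ 3 \<le> 6 * real X"
        using H47 Z47 by (simp add: Z_def)
      hence "real_of_int (24 * H + 5 * h ^ 3) \<le> real_of_int (6 * int X)" by simp
      thus ?thesis by (simp only: of_int_le_iff)
    qed
    define T where "T = nat \<lfloor>C * Z powr (3 * e)\<rfloor>"
    have TZ: "real T \<le> C * Z powr (3 * e)" using C by (simp add: T_def)
    have T: "divisor_count (nat M) \<le> T" if M: "0 < M" "M \<le> 21 * int X ^ 6" for M
    proof -
      have "real_of_int M \<le> real_of_int (21 * int X ^ 6)" using M(2) by (simp only: of_int_le_iff)
      also have "\<dots> \<le> Z ^ 6" by (simp add: Z_def power_mult_distrib)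
      finally have "real (nat M) \<le> Z ^ 6" using M(1) by simp
      hence "real (nat M) powr (e/2) \<le> (Z ^ 6) powr (e/2)" using e by (intro powr_mono2) auto
      also have "Z ^ 6 = Z powr 6" using Z by (simp add: powr_numeral)
      also have "(Z powr 6) powr (e/2) = Z powr (3 * e)" by (simp add: powr_powr)
      finally have "C * real (nat M) powr (e/2) \<le> C * Z powr (3 * e)"
        using C(1) by (intro mult_left_mono) auto
      hence "real (divisor_count (nat M)) \<le> C * Z powr (3 * e)" using C(2)[of "nat M"] M(1) by simp
      thus ?thesis unfolding T_def by linarith
    qed
    have "nat (H + 1) * (nat (H\<^sup>2 div (2 * int X)) * nat (H ^ 4 div (3 * (int X)\<^sup>2)) * T\<^sup>2) < X"
    proof (rule few_bad_starting_points)
      have "Z powr e > 0" using Z by simp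
      thus "16 * C\<^sup>2 < 3 * (2 * real X) powr e" using CZ unfolding Z_def by linarith
    qed (use Z H1 HZ C TZ in \<open>simp_all add: Z_def\<close>)
    then obtain N' where N': "int X \<le> N'" "N' < 2 * int X"
      "sidon_set ((\<lambda>n. n ^ 3) ` {N'..N' + H})"
      using exists_sidon_interval[of "int X" H T] Z(3) H1 HX small T by auto
    define N where "N = nat N'"
    have N: "int N = N'" "X \<le> N" "N < 2 * X" using N' by (simp_all add: N_def)
    have "{int n ^ 3 | n::nat. n > 0 \<and> N \<le> n \<and> real n \<le> real N + real N powr (4/7 - \<epsilon>)}
            \<subseteq> (\<lambda>n. n ^ 3) ` {N'..N' + H}"
    proof clarify
      fix n :: nat
      assume n: "N \<le> n" "real n \<le> real N + real N powr (4/7 - \<epsilon>)"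
      have "real N powr (4/7 - \<epsilon>) \<le> real N powr (4/7 - e)"
        using N(2) Z(3) e by (intro powr_mono) auto
      also have "\<dots> \<le> Z powr (4/7 - e)" using N(3) e by (intro powr_mono2) (auto simp: Z_def)
      finally have "real_of_int (int n - int N) \<le> Z powr (4/7 - e)" using n(2) by simp
      hence "int n - int N \<le> H" by (simp only: H_def le_floor_iff)
      hence "int n \<in> {N'..N' + H}" using n(1) N(1) by auto
      thus "int n ^ 3 \<in> (\<lambda>n. n ^ 3) ` {N'..N' + H}" by (rule imageI)
    qed
    hence "sidon_set {int n ^ 3 | n::nat.
        n > 0 \<and> N \<le> n \<and> real n \<le> real N + real N powr (4/7 - \<epsilon>)}"
      by (rule sidon_set_subset[OF N'(3)])
    moreover have "k < N" "N > 0" using X(1) N(2) Z(3) by simp_all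
    ultimately show ?thesis by blast
  qed
  thus ?thesis
    unfolding finite_nat_set_iff_bounded_le by (simp add: Bex_def not_le) (blast intro: conjI)
qed

end
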